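(* Let $p_1,p_2,p_3,n\in\mathbb{Z}^{+}$, let $P_1^3=(p_1,p_2,p_3)$ be an oriented pretzel link, and let $\mathbb{Z}_n$ be the dihedral quandle. Put $P=p_1p_2+p_1p_3+p_2p_3$, $Q=\gcd(p_1,p_2,p_3)$, $D_1=\gcd(Q,n)$ and $D_2=\gcd\left(\frac{|P|}{Q},n\right)$. Then the coloring number of $P_1^3$ is $$|\mathrm{Hom}(\mathcal{Q}(P_1^3),\mathbb{Z}_n)|=\begin{cases} n & \text{if } \gcd(P,n)=1,\\ D_1D_2\,n & \text{otherwise.}\end{cases}$$
   Context: A quandle is a set $X$ with a binary operation $\triangleright$ such that $x\triangleright x=x$ for all $x$; for each $y$ the map $x\mapsto x\triangleright y$ is invertible; and $(x\triangleright y)\triangleright z=(x\triangleright z)\triangleright(y\triangleright z)$ for all $x,y,z$. A quandle homomorphism $f$ satisfies $f(x\triangleright y)=f(x)\triangleright f(y)$. The dihedral quandle $\mathbb{Z}_n$ is the set of integers modulo $n$ with $x\triangleright y=2y-x \pmod n$. For an oriented link $K$ with diagram $D$, the fundamental quandle $\mathcal{Q}(K)$ is the quandle generated by the arcs of $D$ with one relation per crossing: if the overcrossing arc is $y$ (pointing up), and $x$ is the undercrossing arc on the right of $y$, then the undercrossing arc on the left of $y$ is $x\triangleright y$. $\mathrm{Hom}(\mathcal{Q}(K),X)$ is the set of quandle homomorphisms (colorings of $K$ by $X$); its cardinality is the coloring number of $K$ (with respect to $X$). Pretzel link: for nonzero integers $p_1,\dots,p_m$, the pretzel link $(p_1,\dots,p_m)$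 is formed from $m$ tangles $A_1,\dots,A_m$ placed side by side, where $A_i$ is a vertical column of two strands twisted about each other with $|p_i|$ crossings, all of one fixed handedness if $p_i>0$ ("positive") and all of the opposite handedness if $p_i<0$ ("negative"). The NE endpoint of $A_i$ is joined to the NW endpoint of $A_{i+1}$, the SE endpoint of $A_i$ to the SW endpoint of $A_{i+1}$, and the outer endpoints are closed up by joining the NW (resp. SW) endpoint of $A_1$ to the NE (resp. SE) endpoint of $A_m$. Any orientation of the link may be chosen. *)

theory Defs
  imports Main "HOL-Library.FuncSet"
begin

record 'a quandle =
  elems :: "'a set"
  qop :: "'a \<Rightarrow> 'a \<Rightarrow> 'a"

definition is_quandle :: "'a quandle \<Rightarrow> bool" where
  "is_quandle X \<longleftrightarrow>
     (\<forall>x\<in>elems X. qop X x x = x) \<and>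
     (\<forall>y\<in>elems X. bij_betw (\<lambda>x. qop X x y) (elems X) (elems X)) \<and>
     (\<forall>x\<in>elems X. \<forall>y\<in>elems X. \<forall>z\<in>elems X.
        qop X (qop X x y) z = qop X (qop X x z) (qop X y z))"

text \<open>Homomorphisms are extensional functions, so that their number is meaningful.\<close>

definition quandle_hom :: "'a quandle \<Rightarrow> 'b quandle \<Rightarrow> ('a \<Rightarrow> 'b) set" where
  "quandle_hom X Y =
     {f \<in> elems X \<rightarrow>\<^sub>E elems Y.
        \<forall>x\<in>elems X. \<forall>y\<in>elems X. f (qop X x y) = qop Y (f x) (f y)}"

definition dihedral_quandle :: "int \<Rightarrow> int quandle" where
  "dihedral_quandle n = \<lparr>elems = {0..<n}, qop = (\<lambda>x y. (2 * y - x) mod n)\<rparr>"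

lemma is_quandle_dihedral_quandle:
  assumes "n > 0"
  shows "is_quandle (dihedral_quandle n)"
proof -
  have inv: "(2 * y - (2 * y - x) mod n) mod n = x" if "x \<in> {0..<n}" for x y :: int
    using that by (simp add: mod_diff_right_eq)
  have "bij_betw (\<lambda>x. (2 * y - x) mod n) {0..<n} {0..<n}" for y
    by (rule bij_betw_byWitness[where f' = "\<lambda>x. (2 * y - x) mod n"]) (use assms inv in auto)
  moreover have "(2 * z - (2 * y - x) mod n) mod n =
      (2 * ((2 * z - y) mod n) - (2 * z - x) mod n) mod n" for x y z :: int
  proof -
    have "(2 * ((2 * z - y) mod n) - (2 * z - x) mod n) mod n = (2 * (2 * z - y) - (2 * z - x)) mod n"
      using mod_diff_eq[of "2 * ((2 * z - y) mod n)" n "2 * z - x"]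
        mod_diff_eq[of "2 * (2 * z - y)" n "2 * z - x"]
      by (simp add: mod_mult_right_eq mod_diff_right_eq mod_diff_left_eq)
    also have "2 * (2 * z - y) - (2 * z - x) = 2 * z - (2 * y - x)"
      by simp
    finally show ?thesis
      by (simp add: mod_diff_right_eq)
  qed
  ultimately show ?thesis
    by (simp add: is_quandle_def dihedral_quandle_def)
qed


text \<open>
  The quandle presented by generators \<open>G\<close> and relations \<open>R\<close>: terms over \<open>G\<close> modulo the least
  congruence containing \<open>R\<close> and the quandle axioms.  \<open>QInv s t\<close> stands for the preimage of
  \<open>s\<close> under the bijection \<open>x \<mapsto> x \<triangleright> t\<close>.
\<close>

datatype 'g qterm = QGen 'g | QOp "'g qterm" "'g qterm" | QInv "'g qterm" "'g qterm"

definition qterms :: "'g set \<Rightarrow> 'g qterm set" where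
  "qterms G = {t. set_qterm t \<subseteq> G}"

inductive_set pres_cong :: "'g set \<Rightarrow> ('g qterm \<times> 'g qterm) set \<Rightarrow> ('g qterm \<times> 'g qterm) set"
  for G :: "'g set" and R :: "('g qterm \<times> 'g qterm) set" where
  refl: "s \<in> qterms G \<Longrightarrow> (s, s) \<in> pres_cong G R"
| sym: "(s, t) \<in> pres_cong G R \<Longrightarrow> (t, s) \<in> pres_cong G R"
| trans: "(s, t) \<in> pres_cong G R \<Longrightarrow> (t, u) \<in> pres_cong G R \<Longrightarrow> (s, u) \<in> pres_cong G R"
| cong_op: "(s, s') \<in> pres_cong G R \<Longrightarrow> (t, t') \<in> pres_cong G R \<Longrightarrow>
    (QOp s t, QOp s' t') \<in> pres_cong G R"
| cong_inv: "(s, s') \<in> pres_cong G R \<Longrightarrow> (t, t') \<in> pres_cong G R \<Longrightarrow>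
    (QInv s t, QInv s' t') \<in> pres_cong G R"
| idem: "s \<in> qterms G \<Longrightarrow> (QOp s s, s) \<in> pres_cong G R"
| inv_op: "s \<in> qterms G \<Longrightarrow> t \<in> qterms G \<Longrightarrow> (QInv (QOp s t) t, s) \<in> pres_cong G R"
| op_inv: "s \<in> qterms G \<Longrightarrow> t \<in> qterms G \<Longrightarrow> (QOp (QInv s t) t, s) \<in> pres_cong G R"
| distrib: "s \<in> qterms G \<Longrightarrow> t \<in> qterms G \<Longrightarrow> u \<in> qterms G \<Longrightarrow>
    (QOp (QOp s t) u, QOp (QOp s u) (QOp t u)) \<in> pres_cong G R"
| rel: "(s, t) \<in> R \<Longrightarrow> s \<in> qterms G \<Longrightarrow> t \<in> qterms G \<Longrightarrow> (s, t) \<in> pres_cong G R"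

definition presented_quandle ::
    "'g set \<Rightarrow> ('g qterm \<times> 'g qterm) set \<Rightarrow> 'g qterm set quandle" where
  "presented_quandle G R =
     \<lparr>elems = qterms G // pres_cong G R,
      qop = (\<lambda>A B. \<Union>s\<in>A. \<Union>t\<in>B. pres_cong G R `` {QOp s t})\<rparr>"

lemma qterms_simps [simp]:
  "QGen g \<in> qterms G \<longleftrightarrow> g \<in> G"
  "QOp s t \<in> qterms G \<longleftrightarrow> s \<in> qterms G \<and> t \<in> qterms G"
  "QInv s t \<in> qterms G \<longleftrightarrow> s \<in> qterms G \<and> t \<in> qterms G"
  by (auto simp: qterms_def)

lemma pres_cong_qterms: "(s, t) \<in> pres_cong G R \<Longrightarrow> s \<in> qterms G \<and> t \<in> qterms G"
  by (induction rule: pres_cong.induct) auto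

lemma equiv_pres_cong: "equiv (qterms G) (pres_cong G R)"
proof (rule equivI)
  show "pres_cong G R \<subseteq> qterms G \<times> qterms G"
    by (auto dest: pres_cong_qterms)
  show "refl_on (qterms G) (pres_cong G R)"
    by (auto simp: refl_on_def intro: pres_cong.refl)
  show "sym (pres_cong G R)"
    by (auto simp: sym_def intro: pres_cong.sym)
  show "trans (pres_cong G R)"
    by (meson pres_cong.trans transI)
qed

lemma qop_presented_quandle:
  assumes "s \<in> qterms G" "t \<in> qterms G"
  shows "qop (presented_quandle G R) (pres_cong G R `` {s}) (pres_cong G R `` {t}) =
    pres_cong G R `` {QOp s t}"
proof -
  have "congruent2 (pres_cong G R) (pres_cong G R) (\<lambda>s t. pres_cong G R `` {QOp s t})"
    by (rule congruent2I'[of "pres_cong G R"])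
      (metis equiv_class_eq[OF equiv_pres_cong] pres_cong.cong_op)
  from UN_equiv_class2[OF equiv_pres_cong equiv_pres_cong this assms] show ?thesis
    by (simp add: presented_quandle_def)
qed

lemma is_quandle_presented_quandle: "is_quandle (presented_quandle G R)"
proof -
  let ?E = "pres_cong G R" and ?X = "presented_quandle G R"
  let ?c = "\<lambda>s. ?E `` {s}"
  have elems: "elems ?X = ?c ` qterms G"
    by (auto simp: presented_quandle_def quotient_def)
  have eq: "?c s = ?c t \<longleftrightarrow> (s, t) \<in> ?E" if "s \<in> qterms G" "t \<in> qterms G" for s t
    using that by (rule eq_equiv_class_iff[OF equiv_pres_cong])
  have "bij_betw (\<lambda>A. qop ?X A (?c t)) (elems ?X) (elems ?X)" if t: "t \<in> qterms G" for t
  proof (rule bij_betwI')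
    fix A B assume "A \<in> elems ?X" "B \<in> elems ?X"
    then obtain s u where su: "s \<in> qterms G" "u \<in> qterms G" "A = ?c s" "B = ?c u"
      by (auto simp: elems)
    have "(s, u) \<in> ?E" if "(QOp s t, QOp u t) \<in> ?E"
      using pres_cong.cong_inv[OF that pres_cong.refl[OF t]] su(1,2) t
      by (meson pres_cong.inv_op pres_cong.sym pres_cong.trans)
    then show "qop ?X A (?c t) = qop ?X B (?c t) \<longleftrightarrow> A = B"
      using su t by (auto simp: qop_presented_quandle eq intro: pres_cong.cong_op pres_cong.refl)
  next
    fix A assume "A \<in> elems ?X"
    then show "qop ?X A (?c t) \<in> elems ?X"
      using t by (auto simp: elems qop_presented_quandle)
  next
    fix A assume "A \<in> elems ?X"
    then obtain s where s: "s \<in> qterms G" "A = ?c s"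
      by (auto simp: elems)
    then have "A = qop ?X (?c (QInv s t)) (?c t)"
      using t by (simp add: qop_presented_quandle eq pres_cong.op_inv pres_cong.sym)
    then show "\<exists>B\<in>elems ?X. A = qop ?X B (?c t)"
      using s t by (auto simp: elems)
  qed
  then show ?thesis
    unfolding is_quandle_def elems
    by (auto simp: qop_presented_quandle eq pres_cong.idem pres_cong.distrib)
qed


text \<open>
  A link diagram is given by its crossings, each drawn as an X with four ends (its corners),
  an involution \<open>glue\<close> telling which end is joined to which by the strands outside the crossings,
  and the pair of opposite corners joined by the overcrossing strand.
\<close>

datatype corner = NW | NE | SE | SW

text \<open>The next corner, clockwise.\<close>

fun cw :: "corner \<Rightarrow> corner" where
  "cw NW = NE" | "cw NE = SE" | "cw SE = SW" | "cw SW = NW"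

definition opposite :: "corner \<Rightarrow> corner" where
  "opposite k = cw (cw k)"

definition ccw :: "corner \<Rightarrow> corner" where
  "ccw k = cw (cw (cw k))"

record 'c diagram =
  crossings :: "'c set"
  glue :: "'c \<times> corner \<Rightarrow> 'c \<times> corner"
  over :: "'c \<Rightarrow> corner set"

definition ends :: "'c diagram \<Rightarrow> ('c \<times> corner) set" where
  "ends D = crossings D \<times> UNIV"

definition is_diagram :: "'c diagram \<Rightarrow> bool" where
  "is_diagram D \<longleftrightarrow>
     finite (crossings D) \<and>
     (\<forall>e\<in>ends D. glue D e \<in> ends D \<and> glue D e \<noteq> e \<and> glue D (glue D e) = e) \<and>
     (\<forall>c\<in>crossings D. over D c \<in> {{NW, SE}, {NE, SW}})"

text \<open>
  An orientation says at which ends the strands point away from the crossing: each of the two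
  strands through a crossing enters at one end and leaves at the opposite one, and a strand
  joining two ends leaves one crossing end and enters at the other.
\<close>

definition orientation :: "'c diagram \<Rightarrow> ('c \<times> corner \<Rightarrow> bool) \<Rightarrow> bool" where
  "orientation D out \<longleftrightarrow>
     (\<forall>c\<in>crossings D. \<forall>k. out (c, opposite k) \<longleftrightarrow> \<not> out (c, k)) \<and>
     (\<forall>e\<in>ends D. out (glue D e) \<longleftrightarrow> \<not> out e)"

text \<open>
  An arc is a class of ends connected without passing under a crossing.
  The relation \<open>arc_step\<close> is symmetric for diagrams, so its reflexive transitive closure is an
  equivalence relation.
\<close>

definition arc_step :: "'c diagram \<Rightarrow> (('c \<times> corner) \<times> ('c \<times> corner)) set" where
  "arc_step D = {(e, glue D e) | e. e \<in> ends D} \<union>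
     {((c, k), (c, opposite k)) | c k. c \<in> crossings D \<and> k \<in> over D c}"

definition arc_of :: "'c diagram \<Rightarrow> 'c \<times> corner \<Rightarrow> ('c \<times> corner) set" where
  "arc_of D e = (arc_step D)\<^sup>* `` {e}"

definition arcs :: "'c diagram \<Rightarrow> ('c \<times> corner) set set" where
  "arcs D = arc_of D ` ends D"

text \<open>
  If the overcrossing strand leaves the crossing at corner \<open>k\<close>, then, looking in that direction,
  the corner on its right is \<open>cw k\<close> and the corner on its left is \<open>ccw k\<close>.
\<close>

definition crossing_relations ::
    "'c diagram \<Rightarrow> ('c \<times> corner \<Rightarrow> bool) \<Rightarrow>
       (('c \<times> corner) set qterm \<times> ('c \<times> corner) set qterm) set" where
  "crossing_relations D out =
     {(QOp (QGen (arc_of D (c, cw k))) (QGen (arc_of D (c, k))), QGen (arc_of D (c, ccw k))) | c k.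
        c \<in> crossings D \<and> k \<in> over D c \<and> out (c, k)}"

definition fundamental_quandle ::
    "'c diagram \<Rightarrow> ('c \<times> corner \<Rightarrow> bool) \<Rightarrow> ('c \<times> corner) set qterm set quandle" where
  "fundamental_quandle D out = presented_quandle (arcs D) (crossing_relations D out)"


text \<open>
  The standard diagram of a pretzel link.  The crossing \<open>(i, j)\<close> is the one in column \<open>i\<close>
  (counted from the left) and row \<open>j\<close> (counted from the top).  A crossing in a positive column has
  the strand from SW to NE on top.
\<close>

definition column_height :: "int list \<Rightarrow> nat \<Rightarrow> nat" where
  "column_height ps i = nat \<bar>ps ! i\<bar>"

definition next_column :: "int list \<Rightarrow> nat \<Rightarrow> nat" where
  "next_column ps i = (if Suc i = length ps then 0 else Suc i)"

definition prev_column :: "int list \<Rightarrow> nat \<Rightarrow> nat" where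
  "prev_column ps i = (if i = 0 then length ps - 1 else i - 1)"

fun pretzel_glue :: "int list \<Rightarrow> (nat \<times> nat) \<times> corner \<Rightarrow> (nat \<times> nat) \<times> corner" where
  "pretzel_glue ps ((i, j), NW) =
     (if j = 0 then ((prev_column ps i, 0), NE) else ((i, j - 1), SW))"
| "pretzel_glue ps ((i, j), NE) =
     (if j = 0 then ((next_column ps i, 0), NW) else ((i, j - 1), SE))"
| "pretzel_glue ps ((i, j), SW) =
     (if Suc j = column_height ps i
      then (let i' = prev_column ps i in ((i', column_height ps i' - 1), SE))
      else ((i, Suc j), NW))"
| "pretzel_glue ps ((i, j), SE) =
     (if Suc j = column_height ps i
      then (let i' = next_column ps i in ((i', column_height ps i' - 1), SW))
      else ((i, Suc j), NE))"

definition pretzel :: "int list \<Rightarrow> (nat \<times> nat) diagram" where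
  "pretzel ps =
     \<lparr>crossings = {(i, j). i < length ps \<and> j < column_height ps i},
      glue = pretzel_glue ps,
      over = (\<lambda>(i, j). if ps ! i > 0 then {NE, SW} else {NW, SE})\<rparr>"

lemma is_diagram_pretzel:
  assumes "ps \<noteq> []" "0 \<notin> set ps"
  shows "is_diagram (pretzel ps)"
proof -
  have pos: "column_height ps i > 0" if "i < length ps" for i
    using that assms(2) by (auto simp: column_height_def) (metis nth_mem)
  have columns: "next_column ps i < length ps" "prev_column ps i < length ps"
    "next_column ps (prev_column ps i) = i" "prev_column ps (next_column ps i) = i"
    if "i < length ps" for i
    using that assms(1) by (auto simp: next_column_def prev_column_def)
  have "{(i, j). i < length ps \<and> j < column_height ps i} =
      (SIGMA i:{..<length ps}. {..<column_height ps i})"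
    by auto
  then have "finite (crossings (pretzel ps))"
    by (simp add: pretzel_def)
  moreover have "glue (pretzel ps) e \<in> ends (pretzel ps) \<and> glue (pretzel ps) e \<noteq> e \<and>
      glue (pretzel ps) (glue (pretzel ps) e) = e" if "e \<in> ends (pretzel ps)" for e
  proof -
    obtain i j k where e: "e = ((i, j), k)"
      by (metis surj_pair)
    have i: "i < length ps" and j: "j < column_height ps i"
      using that by (auto simp: e ends_def pretzel_def)
    show ?thesis
      using j pos[OF i] pos[OF columns(1)[OF i]] pos[OF columns(2)[OF i]]
      by (cases k) (auto simp: e ends_def pretzel_def Let_def columns[OF i] i)
  qed
  ultimately show ?thesis
    by (auto simp: is_diagram_def pretzel_def)
qed

end

theory Submission
  imports Defs
begin

text \<open>
  A homomorphism from a presented quandle to a quandle \<open>X\<close> is the same thing as an assignment of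
  elements of \<open>X\<close> to the generators that satisfies the relations. For the fundamental quandle of
  a link, this means a colouring of the crossing ends that is constant along the arcs and obeys one
  equation per crossing (\<open>card_quandle_hom_fundamental_quandle\<close>). Over the dihedral quandle that
  equation reads \<open>left + right = 2 * over\<close> modulo \<open>n\<close>. It is symmetric in left and right, so the
  orientation drops out.

  In a twisted column, each crossing turns the pair \<open>(x, x + d)\<close> of colours at its top into the pair
  \<open>(x + d, x + 2 * d)\<close> at its bottom. A column is therefore an arithmetic progression, determined
  by its two top colours. Since neighbouring columns share a top colour, a colouring is determined by
  the top left colours \<open>a\<^sub>i\<close> of the columns, with differences \<open>d\<^sub>i = a\<^sub>i\<^sub>+\<^sub>1 - a\<^sub>i\<close>. The strands at the
  bottom match exactly if all products \<open>p\<^sub>i * d\<^sub>i\<close> agree modulo \<open>n\<close>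
  (\<open>bij_betw_top_colorings\<close>).

  For three columns, the colour \<open>a\<^sub>0\<close> is free and contributes a factor \<open>n\<close>. Since
  \<open>d\<^sub>2 = - d\<^sub>0 - d\<^sub>1\<close>, the pair \<open>(d\<^sub>0, d\<^sub>1)\<close> runs through the kernel modulo \<open>n\<close> of the matrix with
  rows \<open>(p1, - p2)\<close> and \<open>(p3, p2 + p3)\<close>. Its determinant is \<open>P\<close> and the gcd of its
  entries is \<open>Q\<close>. The kernel modulo \<open>n\<close> of a two by two matrix has
  \<open>gcd det (n * gcd entries n)\<close> elements (\<open>card_kernel_mod\<close>), which for
  \<open>Q * Q dvd P\<close> is the product of \<open>gcd Q n\<close> and \<open>gcd (P div Q) n\<close>, that is, the
  number predicted by the invariant factors \<open>Q\<close> and \<open>P div Q\<close>. If \<open>P\<close> and \<open>n\<close> are coprime,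
  both factors are 1, so the two cases of the theorem are one formula.
\<close>

section \<open>Homomorphisms from a presented quandle\<close>

text \<open>
  On carriers that are quandles, \<open>inv_into\<close> is the genuine inverse of the right translation, as
  \<open>QInv\<close> requires.
\<close>

fun eval_qterm :: "'a quandle \<Rightarrow> ('g \<Rightarrow> 'a) \<Rightarrow> 'g qterm \<Rightarrow> 'a" where
  "eval_qterm X f (QGen g) = f g"
| "eval_qterm X f (QOp s t) = qop X (eval_qterm X f s) (eval_qterm X f t)"
| "eval_qterm X f (QInv s t) =
     inv_into (elems X) (\<lambda>x. qop X x (eval_qterm X f t)) (eval_qterm X f s)"

lemma qop_in_elems:
  "is_quandle X \<Longrightarrow> x \<in> elems X \<Longrightarrow> y \<in> elems X \<Longrightarrow> qop X x y \<in> elems X"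
  unfolding is_quandle_def by (meson bij_betwE)

lemma eval_qterm_in_elems:
  assumes X: "is_quandle X" and f: "f \<in> G \<rightarrow> elems X" and t: "t \<in> qterms G"
  shows "eval_qterm X f t \<in> elems X"
  using t
proof (induction t)
  case (QInv s t)
  then show ?case
    using X by (auto simp: is_quandle_def bij_betw_def intro: inv_into_into)
qed (use X f in \<open>auto intro: qop_in_elems\<close>)

text \<open>
  The congruence is generated by the relations and the quandle axioms, and the target satisfies both.
  Hence evaluation descends to the presented quandle.
\<close>

lemma eval_qterm_pres_cong:
  assumes X: "is_quandle X" and f: "f \<in> G \<rightarrow> elems X"
    and R: "\<And>s t. (s, t) \<in> R \<Longrightarrow> eval_qterm X f s = eval_qterm X f t"
    and st: "(s, t) \<in> pres_cong G R"
  shows "eval_qterm X f s = eval_qterm X f t"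
  using st
proof (induction rule: pres_cong.induct)
  case (inv_op s t)
  then have "eval_qterm X f s \<in> elems X" "eval_qterm X f t \<in> elems X"
    by (simp_all add: eval_qterm_in_elems[OF X f])
  then show ?case
    using X by (auto simp: is_quandle_def bij_betw_def intro: inv_into_f_f)
next
  case (op_inv s t)
  then have "eval_qterm X f s \<in> elems X" "eval_qterm X f t \<in> elems X"
    by (simp_all add: eval_qterm_in_elems[OF X f])
  then show ?case
    using X by (auto simp: is_quandle_def bij_betw_def intro!: f_inv_into_f[where f = "\<lambda>x. qop X x _"])
next
  case (idem s)
  then show ?case
    using X eval_qterm_in_elems[OF X f] by (auto simp: is_quandle_def)
next
  case (distrib s t u)
  then show ?case
    using X eval_qterm_in_elems[OF X f] by (simp add: is_quandle_def)
qed (use R in auto)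

text \<open>
  A homomorphism is only required to respect \<open>\<triangleright>\<close>, but it then respects the inverse translations
  too, because right translations of the target are injective. So it is determined by its values on the
  generators.
\<close>

lemma quandle_hom_presented_eval:
  assumes X: "is_quandle X" and h: "h \<in> quandle_hom (presented_quandle G R) X"
    and t: "t \<in> qterms G"
  shows "h (pres_cong G R `` {t}) = eval_qterm X (\<lambda>g. h (pres_cong G R `` {QGen g})) t"
proof -
  let ?c = "\<lambda>s. pres_cong G R `` {s}" and ?P = "presented_quandle G R"
  have in_P: "?c s \<in> elems ?P" if "s \<in> qterms G" for s
    using that by (auto simp: presented_quandle_def quotient_def)
  have in_X: "h (?c s) \<in> elems X" if "s \<in> qterms G" for s
    using h in_P[OF that] by (auto simp: quandle_hom_def)
  have op: "h (?c (QOp s u)) = qop X (h (?c s)) (h (?c u))" if "s \<in> qterms G" "u \<in> qterms G" for s u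
    using h in_P that by (auto simp: quandle_hom_def simp flip: qop_presented_quandle)
  show ?thesis
    using t
  proof (induction t)
    case (QInv s u)
    then have su: "s \<in> qterms G" "u \<in> qterms G"
      by auto
    have "?c (QOp (QInv s u) u) = ?c s"
      using su by (intro equiv_class_eq[OF equiv_pres_cong] pres_cong.op_inv)
    then have "h (?c s) = qop X (h (?c (QInv s u))) (h (?c u))"
      using op[of "QInv s u" u] su by simp
    moreover have "inj_on (\<lambda>x. qop X x (h (?c u))) (elems X)"
      using X in_X su by (auto simp: is_quandle_def bij_betw_def)
    ultimately show ?case
      using QInv su in_X[of "QInv s u"] by (auto dest: inv_into_f_f)
  qed (use op in auto)
qed

text \<open>
  The universal property of the presentation: restriction to the generators has evaluation of terms as
  its inverse.
\<close>

lemma bij_betw_quandle_hom_presented: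
  assumes X: "is_quandle X" and R: "R \<subseteq> qterms G \<times> qterms G"
  shows "bij_betw (\<lambda>h. \<lambda>g\<in>G. h (pres_cong G R `` {QGen g}))
    (quandle_hom (presented_quandle G R) X)
    {f \<in> G \<rightarrow>\<^sub>E elems X. \<forall>(s, t)\<in>R. eval_qterm X f s = eval_qterm X f t}"
    (is "bij_betw ?r ?H ?F")
proof -
  let ?E = "pres_cong G R" and ?P = "presented_quandle G R"
  let ?c = "\<lambda>s. ?E `` {s}"
  have elems: "elems ?P = ?c ` qterms G"
    by (auto simp: presented_quandle_def quotient_def)
  have restrict: "eval_qterm X (restrict f G) t = eval_qterm X f t" if "t \<in> qterms G" for f t
    using that by (induction t) auto
  have hom_eval: "h (?c t) = eval_qterm X (?r h) t" if "h \<in> ?H" "t \<in> qterms G" for h t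
    using quandle_hom_presented_eval[OF X that] restrict[OF that(2)] by simp
  show ?thesis
  proof (rule bij_betwI')
    fix h h' assume h: "h \<in> ?H" "h' \<in> ?H"
    show "?r h = ?r h' \<longleftrightarrow> h = h'"
    proof
      assume eq: "?r h = ?r h'"
      have "h A = h' A" if "A \<in> elems ?P" for A
        using that hom_eval[OF h(1)] hom_eval[OF h(2)] eq by (auto simp: elems)
      moreover have "h \<in> extensional (elems ?P)" "h' \<in> extensional (elems ?P)"
        using h by (auto simp: quandle_hom_def PiE_def)
      ultimately show "h = h'"
        by (meson extensionalityI)
    qed simp
  next
    fix h assume h: "h \<in> ?H"
    have "eval_qterm X (?r h) s = eval_qterm X (?r h) t" if st: "(s, t) \<in> R" for s t
    proof -
      have "s \<in> qterms G" "t \<in> qterms G"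
        using st R by auto
      moreover from this have "?c s = ?c t"
        using st by (intro equiv_class_eq[OF equiv_pres_cong] pres_cong.rel)
      ultimately show ?thesis
        by (simp flip: hom_eval[OF h])
    qed
    moreover have "?r h \<in> G \<rightarrow>\<^sub>E elems X"
      using h by (auto simp: quandle_hom_def elems)
    ultimately show "?r h \<in> ?F"
      by auto
  next
    fix f assume f: "f \<in> ?F"
    then have fG: "f \<in> G \<rightarrow> elems X"
      by auto
    define h where "h = (\<lambda>A\<in>elems ?P. eval_qterm X f (SOME t. t \<in> A))"
    have h: "h (?c t) = eval_qterm X f t" if t: "t \<in> qterms G" for t
    proof -
      have "(SOME u. u \<in> ?c t) \<in> ?c t"
        using equiv_class_self[OF equiv_pres_cong t] by (rule someI)
      then have "(t, SOME u. u \<in> ?c t) \<in> ?E"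
        by auto
      then have "eval_qterm X f t = eval_qterm X f (SOME u. u \<in> ?c t)"
        by (rule eval_qterm_pres_cong[OF X fG, rotated]) (use f in auto)
      then show ?thesis
        using t by (simp add: h_def elems)
    qed
    have "h \<in> ?H"
      using eval_qterm_in_elems[OF X fG]
      by (auto simp: quandle_hom_def h elems qop_presented_quandle) (auto simp: h_def elems)
    moreover have "f = ?r h"
      using f by (auto simp: fun_eq_iff h PiE_def extensional_def)
    ultimately show "\<exists>h\<in>?H. f = ?r h"
      by blast
  qed
qed

section \<open>Colourings of a link diagram\<close>

text \<open>
  Colouring the crossing ends instead of the arcs keeps every condition local: the arcs, which are
  classes under a transitive closure, no longer appear.
\<close>

definition diagram_colorings ::
    "'c diagram \<Rightarrow> ('c \<times> corner \<Rightarrow> bool) \<Rightarrow> 'a quandle \<Rightarrow> ('c \<times> corner \<Rightarrow> 'a) set" where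
  "diagram_colorings D out X =
     {c \<in> ends D \<rightarrow>\<^sub>E elems X.
        (\<forall>e\<in>ends D. c (glue D e) = c e) \<and>
        (\<forall>x\<in>crossings D. \<forall>k\<in>over D x. c (x, opposite k) = c (x, k) \<and>
           (out (x, k) \<longrightarrow> qop X (c (x, cw k)) (c (x, k)) = c (x, ccw k)))}"

text \<open>
  Arcs are defined by reachability, so one step of the relation identifies two arcs only because the
  relation is symmetric: gluing is an involution, and the overcrossing strand consists of two opposite
  corners.
\<close>

lemma arc_of_eq_if_arc_step:
  assumes "is_diagram D" "(e, e') \<in> arc_step D"
  shows "arc_of D e = arc_of D e'"
proof -
  have "sym (arc_step D)"
  proof (rule symI)
    fix e e' assume "(e, e') \<in> arc_step D"
    then consider "e \<in> ends D" "e' = glue D e"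
      | x k where "x \<in> crossings D" "k \<in> over D x" "e = (x, k)" "e' = (x, opposite k)"
      by (auto simp: arc_step_def)
    then show "(e', e) \<in> arc_step D"
    proof cases
      case 1
      then have "e' \<in> ends D" "e = glue D e'"
        using assms(1) by (auto simp: is_diagram_def)
      then show ?thesis
        unfolding arc_step_def by blast
    next
      case 2
      then have "over D x = {NW, SE} \<or> over D x = {NE, SW}"
        using assms(1) by (auto simp: is_diagram_def)
      then have "opposite k \<in> over D x"
        using 2(2) by (cases k) (auto simp: opposite_def)
      moreover have "opposite (opposite k) = k"
        by (cases k) (simp_all add: opposite_def)
      moreover have "((x, opposite k), (x, opposite (opposite k))) \<in> arc_step D"
        using 2(1) \<open>opposite k \<in> over D x\<close> unfolding arc_step_def by blast
      ultimately show ?thesis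
        using 2(3,4) by simp
    qed
  qed
  then have "(e', e) \<in> arc_step D"
    using assms(2) by (auto dest: symD)
  then show ?thesis
    using assms(2) unfolding arc_of_def by (blast intro: converse_rtrancl_into_rtrancl)
qed

text \<open>
  A colouring of ends that does not change along the steps takes a single value on each arc, and
  any end of the arc may be chosen to read it off.
\<close>

lemma bij_betw_diagram_colorings:
  assumes D: "is_diagram D"
  shows "bij_betw (\<lambda>f. \<lambda>e\<in>ends D. f (arc_of D e))
    {f \<in> arcs D \<rightarrow>\<^sub>E elems X. \<forall>(s, t)\<in>crossing_relations D out. eval_qterm X f s = eval_qterm X f t}
    (diagram_colorings D out X)"
    (is "bij_betw ?r ?F ?C")
proof (rule bij_betwI')
  fix f f' assume f: "f \<in> ?F" "f' \<in> ?F"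
  show "?r f = ?r f' \<longleftrightarrow> f = f'"
  proof
    assume "?r f = ?r f'"
    then have "f (arc_of D e) = f' (arc_of D e)" if "e \<in> ends D" for e
      using that by (metis restrict_apply')
    then have "f A = f' A" if "A \<in> arcs D" for A
      using that by (auto simp: arcs_def)
    moreover have "f \<in> extensional (arcs D)" "f' \<in> extensional (arcs D)"
      using f by (auto simp: PiE_def)
    ultimately show "f = f'"
      by (meson extensionalityI)
  qed simp
next
  fix f assume f: "f \<in> ?F"
  have glue: "glue D e \<in> ends D" "arc_of D (glue D e) = arc_of D e" if e: "e \<in> ends D" for e
  proof -
    show "glue D e \<in> ends D"
      using D e by (simp add: is_diagram_def)
    have "(e, glue D e) \<in> arc_step D"
      using e unfolding arc_step_def by blast
    then show "arc_of D (glue D e) = arc_of D e"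
      using arc_of_eq_if_arc_step[OF D] by metis
  qed
  have "arc_of D (x, opposite k) = arc_of D (x, k)" if "x \<in> crossings D" "k \<in> over D x" for x k
  proof -
    have "((x, k), (x, opposite k)) \<in> arc_step D"
      using that unfolding arc_step_def by blast
    then show ?thesis
      using arc_of_eq_if_arc_step[OF D] by metis
  qed
  moreover have "qop X (f (arc_of D (x, cw k))) (f (arc_of D (x, k))) = f (arc_of D (x, ccw k))"
    if "x \<in> crossings D" "k \<in> over D x" "out (x, k)" for x k
  proof -
    have "(QOp (QGen (arc_of D (x, cw k))) (QGen (arc_of D (x, k))), QGen (arc_of D (x, ccw k)))
        \<in> crossing_relations D out"
      using that by (auto simp: crossing_relations_def)
    then show ?thesis
      using f by fastforce
  qed
  ultimately show "?r f \<in> ?C"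
    using f glue by (auto simp: diagram_colorings_def ends_def arcs_def)
next
  fix c assume c: "c \<in> ?C"
  have step: "c e' = c e" if "(e, e') \<in> arc_step D" for e e'
    using that c by (auto simp: diagram_colorings_def arc_step_def)
  have const: "c e' = c e" if "(e, e') \<in> (arc_step D)\<^sup>*" for e e'
    using that by induction (auto dest: step)
  define f where "f = (\<lambda>A\<in>arcs D. c (SOME e. e \<in> ends D \<and> arc_of D e = A))"
  have f_arc: "f (arc_of D e) = c e" if e: "e \<in> ends D" for e
  proof -
    let ?e = "SOME e'. e' \<in> ends D \<and> arc_of D e' = arc_of D e"
    have "arc_of D ?e = arc_of D e"
      using e someI[of "\<lambda>e'. e' \<in> ends D \<and> arc_of D e' = arc_of D e" e] by blast
    then have "(?e, e) \<in> (arc_step D)\<^sup>*"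
      by (auto simp: arc_of_def)
    then show ?thesis
      using e const by (auto simp: f_def arcs_def)
  qed
  have cE: "c \<in> ends D \<rightarrow>\<^sub>E elems X"
    using c by (simp add: diagram_colorings_def)
  then have fE: "f \<in> arcs D \<rightarrow>\<^sub>E elems X"
    using f_arc by (auto simp: arcs_def) (auto simp: f_def arcs_def)
  have "f \<in> ?F"
    using c fE by (auto simp: crossing_relations_def f_arc ends_def diagram_colorings_def)
  moreover have "c = ?r f"
    using cE by (auto simp: fun_eq_iff f_arc PiE_def extensional_def)
  ultimately show "\<exists>f\<in>?F. c = ?r f"
    by blast
qed

lemma card_quandle_hom_fundamental_quandle:
  assumes "is_diagram D" "is_quandle X"
  shows "card (quandle_hom (fundamental_quandle D out) X) = card (diagram_colorings D out X)"
proof -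
  have "crossing_relations D out \<subseteq> qterms (arcs D) \<times> qterms (arcs D)"
    by (auto simp: crossing_relations_def arcs_def ends_def)
  from bij_betw_trans[OF bij_betw_quandle_hom_presented[OF assms(2) this]
      bij_betw_diagram_colorings[OF assms(1)]]
  show ?thesis
    unfolding fundamental_quandle_def by (rule bij_betw_same_card)
qed

section \<open>Dihedral colourings of positive pretzel links\<close>

text \<open>
  The colours around a crossing are the terms \<open>0\<close>, \<open>1\<close>, \<open>1\<close>, \<open>2\<close> of an arithmetic
  progression that starts at its corner NW.
\<close>

fun corner_offset :: "corner \<Rightarrow> int" where
  "corner_offset NW = 0" | "corner_offset NE = 1" | "corner_offset SW = 1" | "corner_offset SE = 2"

lemma next_prev_column:
  assumes "i < length ps"
  shows "next_column ps i < length ps" "prev_column ps i < length ps"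
    "next_column ps (prev_column ps i) = i" "prev_column ps (next_column ps i) = i"
  using assms by (auto simp: next_column_def prev_column_def)

lemma mod_eq_of_range: "x \<in> {0..<n} \<Longrightarrow> x mod n = x" for x n :: int
  by simp

text \<open>
  In a positive column the overcrossing strand joins NE and SW. It leaves the crossing at one of these
  corners, which makes NW or SE the right hand corner. Both orientations give the same condition, because
  \<open>x \<mapsto> 2 * y - x\<close> is an involution.
\<close>

lemma diagram_colorings_positive_pretzel:
  assumes pos: "\<forall>p\<in>set ps. p > 0"
    and out: "orientation (pretzel ps) out"
  shows "diagram_colorings (pretzel ps) out (dihedral_quandle n) =
    {c \<in> ends (pretzel ps) \<rightarrow>\<^sub>E {0..<n}.
       (\<forall>e\<in>ends (pretzel ps). c (pretzel_glue ps e) = c e) \<and>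
       (\<forall>x\<in>crossings (pretzel ps).
         c (x, SW) = c (x, NE) \<and> c (x, SE) = (2 * c (x, NE) - c (x, NW)) mod n)}"
    (is "?L = ?R")
proof -
  have crossing: "(\<forall>k\<in>over (pretzel ps) x. c (x, opposite k) = c (x, k) \<and>
        (out (x, k) \<longrightarrow> qop (dihedral_quandle n) (c (x, cw k)) (c (x, k)) = c (x, ccw k))) \<longleftrightarrow>
      c (x, SW) = c (x, NE) \<and> c (x, SE) = (2 * c (x, NE) - c (x, NW)) mod n"
    if x: "x \<in> crossings (pretzel ps)" and c: "c \<in> ends (pretzel ps) \<rightarrow>\<^sub>E {0..<n}"
    for x and c :: "(nat \<times> nat) \<times> corner \<Rightarrow> int"
  proof -
    have over: "over (pretzel ps) x = {NE, SW}"
      using x pos by (auto simp: pretzel_def)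
    have one_out: "out (x, SW) \<longleftrightarrow> \<not> out (x, NE)"
      using x out by (auto simp: orientation_def opposite_def dest!: bspec[of _ _ x] spec[of _ NE])
    have "(x, k) \<in> ends (pretzel ps)" for k
      using x by (simp add: ends_def)
    then have "c (x, NW) \<in> {0..<n}" "c (x, SE) \<in> {0..<n}"
      using c by auto
    then have reverse: "(2 * c (x, NE) - c (x, SE)) mod n = c (x, NW) \<longleftrightarrow>
        c (x, SE) = (2 * c (x, NE) - c (x, NW)) mod n"
      by (metis add_diff_cancel_left' diff_add_cancel mod_diff_right_eq mod_eq_of_range)
    show ?thesis
      by (cases "out (x, NE)")
        (simp_all add: over dihedral_quandle_def opposite_def ccw_def reverse one_out, metis+)
  qed
  have [simp]: "elems (dihedral_quandle n) = {0..<n}" "glue (pretzel ps) = pretzel_glue ps"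
    by (simp_all add: dihedral_quandle_def pretzel_def)
  show ?thesis
    unfolding diagram_colorings_def
    by (intro Collect_cong conj_cong ball_cong HOL.refl) (simp_all add: crossing)
qed

text \<open>
  The value \<open>a i\<close> is the colour at the top left of column \<open>i\<close>, hence also at the top right of
  the column before it. The condition says that \<open>p\<^sub>i * d\<^sub>i\<close> is the same for all columns, where \<open>d\<^sub>i\<close>
  is the difference of the two top colours.
\<close>

definition top_colorings :: "int list \<Rightarrow> int \<Rightarrow> (nat \<Rightarrow> int) set" where
  "top_colorings ps n =
     {a \<in> {..<length ps} \<rightarrow>\<^sub>E {0..<n}.
        \<forall>i<length ps. let i' = next_column ps i in
          (ps ! i * (a i' - a i)) mod n = (ps ! i' * (a (next_column ps i') - a i')) mod n}"

text \<open>
  Going down a column continues the arithmetic progression given by its two top colours, so the top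
  colours determine everything. The only gluing conditions that remain are those at the bottom, between
  neighbouring columns.
\<close>

lemma bij_betw_top_colorings:
  assumes pos: "\<forall>p\<in>set ps. p > 0" and n: "n > 0"
    and out: "orientation (pretzel ps) out"
  shows "bij_betw (\<lambda>c. \<lambda>i\<in>{..<length ps}. c ((i, 0), NW))
    (diagram_colorings (pretzel ps) out (dihedral_quandle n)) (top_colorings ps n)"
    (is "bij_betw ?r ?C ?A")
proof -
  define color where "color a i j k =
      (a i + (int j + corner_offset k) * (a (next_column ps i) - a i)) mod n" for a i j k
  have color_SE: "color a i j SE = (2 * color a i j NE - color a i j NW) mod n" for a i j
  proof -
    have "(2 * (x mod n) - y mod n) mod n = (2 * x - y) mod n" for x y
      by (intro mod_diff_cong mod_mult_right_eq mod_mod_trivial)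
    then show ?thesis
      by (simp add: color_def algebra_simps)
  qed
  have color_SW: "color a i j SW = color a i j NE" for a i j
    by (simp add: color_def)
  have color_Suc: "color a i (Suc j) NW = color a i j SW"
    "color a i (Suc j) NE = color a i j SE" for a i j
    by (simp_all add: color_def algebra_simps)
  have height: "column_height ps i > 0" "int (column_height ps i) = ps ! i" if "i < length ps" for i
    using that pos[rule_format, OF nth_mem[OF that]] by (simp_all add: column_height_def)
  have crossings: "(i, j) \<in> crossings (pretzel ps) \<longleftrightarrow> i < length ps \<and> j < column_height ps i" for i j
    by (simp add: pretzel_def)
  have C: "?C = {c \<in> ends (pretzel ps) \<rightarrow>\<^sub>E {0..<n}.
       (\<forall>e\<in>ends (pretzel ps). c (pretzel_glue ps e) = c e) \<and>
       (\<forall>x\<in>crossings (pretzel ps).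
         c (x, SW) = c (x, NE) \<and> c (x, SE) = (2 * c (x, NE) - c (x, NW)) mod n)}"
    by (rule diagram_colorings_positive_pretzel[OF pos out])
  note columns = next_prev_column[of _ ps]
  \<comment> \<open>Both colours are \<open>a i'\<close> plus the total increment of a column; the common summand cancels.\<close>
  have bottom_iff: "color a i' (column_height ps i' - 1) SW = color a i (column_height ps i - 1) SE \<longleftrightarrow>
      (ps ! i * (a i' - a i)) mod n = (ps ! i' * (a (next_column ps i') - a i')) mod n"
    if i: "i < length ps" and i': "i' = next_column ps i" for a i i'
  proof -
    have "i' < length ps"
      using columns(1)[OF i] i' by simp
    then have heights: "int (column_height ps i - 1) = ps ! i - 1"
      "int (column_height ps i' - 1) = ps ! i' - 1"
      using height[OF i] height[of i'] by (simp_all add: of_nat_diff)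
    have "color a i (column_height ps i - 1) SE = (a i' + ps ! i * (a i' - a i)) mod n"
      "color a i' (column_height ps i' - 1) SW =
        (a i' + ps ! i' * (a (next_column ps i') - a i')) mod n"
      unfolding color_def i'[symmetric] heights by (simp_all add: algebra_simps)
    then show ?thesis
      by (auto simp: mod_eq_dvd_iff dvd_diff_commute)
  qed
  have determined: "c ((i, j), k) = color (?r c) i j k"
    if c: "c \<in> ?C" and i: "i < length ps" and j: "j < column_height ps i" for c i j k
  proof -
    let ?a = "?r c"
    have range: "c ((i, j), k) mod n = c ((i, j), k)"
      if "i < length ps" "j < column_height ps i" for i j k
    proof -
      have "((i, j), k) \<in> ends (pretzel ps)"
        using that by (simp add: ends_def crossings)
      then show ?thesis
        using c by (auto simp: C intro!: mod_eq_of_range)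
    qed
    have glue: "c (pretzel_glue ps ((i, j), k)) = c ((i, j), k)"
      if "i < length ps" "j < column_height ps i" for i j k
      using c that by (auto simp: C ends_def crossings)
    have cross: "c ((i, j), SW) = c ((i, j), NE)"
      "c ((i, j), SE) = (2 * c ((i, j), NE) - c ((i, j), NW)) mod n"
      if "i < length ps" "j < column_height ps i" for j
      using c that by (auto simp: C crossings)
    have top: "color ?a i 0 NW = c ((i, 0), NW)" "color ?a i 0 NE = c ((next_column ps i, 0), NW)"
      using i columns(1)[OF i] range[of _ 0 NW] height(1) by (simp_all add: color_def)
    \<comment> \<open>Both upper corners are needed: they determine the lower right one.\<close>
    have "c ((i, j), NW) = color ?a i j NW \<and> c ((i, j), NE) = color ?a i j NE"
      using j
    proof (induction j)
      case 0
      have "c ((next_column ps i, 0), NW) = c ((i, 0), NE)"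
        using glue[OF i height(1)[OF i], of NE] by simp
      then show ?case
        by (simp only: top)
    next
      case (Suc j)
      then have j: "j < column_height ps i"
        by simp
      have "c ((i, Suc j), NW) = c ((i, j), NE)"
        using glue[OF i Suc.prems, of NW] cross(1)[OF i j] by simp
      moreover have "c ((i, Suc j), NE) = (2 * c ((i, j), NE) - c ((i, j), NW)) mod n"
        using glue[OF i Suc.prems, of NE] cross(2)[OF i j] by simp
      ultimately show ?case
        using Suc.IH[OF j] by (simp only: color_Suc color_SW color_SE)
    qed
    then show ?thesis
      using cross[OF i j] by (cases k) (simp_all only: color_SW color_SE)
  qed
  show ?thesis
  proof (rule bij_betwI')
    fix c c' assume c: "c \<in> ?C" "c' \<in> ?C"
    show "?r c = ?r c' \<longleftrightarrow> c = c'"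
    proof
      assume eq: "?r c = ?r c'"
      have "c e = c' e" if "e \<in> ends (pretzel ps)" for e
      proof -
        obtain i j k where "e = ((i, j), k)"
          by (metis surj_pair)
        moreover from this have "i < length ps" "j < column_height ps i"
          using that by (simp_all add: ends_def crossings)
        ultimately show ?thesis
          using determined[OF c(1), of i j k] determined[OF c(2), of i j k] by (simp only: eq)
      qed
      moreover have "c \<in> extensional (ends (pretzel ps))" "c' \<in> extensional (ends (pretzel ps))"
        using c by (auto simp: C PiE_def)
      ultimately show "c = c'"
        by (meson extensionalityI)
    qed simp
  next
    fix c assume c: "c \<in> ?C"
    let ?a = "?r c"
    have "?a \<in> {..<length ps} \<rightarrow>\<^sub>E {0..<n}"
      using c height(1) by (fastforce simp: C ends_def crossings)
    moreover have "(ps ! i * (?a i' - ?a i)) mod n =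
        (ps ! i' * (?a (next_column ps i') - ?a i')) mod n"
      if i: "i < length ps" and i': "i' = next_column ps i" for i i'
    proof -
      let ?h = "column_height ps i" and ?h' = "column_height ps i'"
      have i'_less: "i' < length ps"
        using columns(1)[OF i] i' by simp
      have "((i, ?h - 1), SE) \<in> ends (pretzel ps)"
        using height(1)[OF i] i by (simp add: ends_def crossings)
      then have "c (pretzel_glue ps ((i, ?h - 1), SE)) = c ((i, ?h - 1), SE)"
        using c unfolding C by blast
      then have "c ((i', ?h' - 1), SW) = c ((i, ?h - 1), SE)"
        using height(1)[OF i] i' by (simp add: Let_def)
      moreover have "?h - 1 < ?h" "?h' - 1 < ?h'"
        using height(1)[OF i] height(1)[OF i'_less] by simp_all
      ultimately show ?thesis
        using determined[OF c i, of "?h - 1" SE] determined[OF c i'_less, of "?h' - 1" SW]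
          bottom_iff[OF i i', of ?a] by metis
    qed
    ultimately show "?r c \<in> ?A"
      by (auto simp: top_colorings_def Let_def)
  next
    fix a assume a: "a \<in> ?A"
    define c where "c = (\<lambda>((i, j), k)\<in>ends (pretzel ps). color a i j k)"
    have c: "c ((i, j), k) = color a i j k" if "i < length ps" "j < column_height ps i" for i j k
      using that by (simp add: c_def ends_def crossings)
    have bottom: "color a (next_column ps i) (column_height ps (next_column ps i) - 1) SW =
        color a i (column_height ps i - 1) SE" if i: "i < length ps" for i
      unfolding bottom_iff[OF i HOL.refl] using a i by (simp add: top_colorings_def Let_def)
    have top: "color a (next_column ps i) 0 NW = color a i 0 NE" for i
      by (simp add: color_def)
    have "c (pretzel_glue ps ((i, j), k)) = c ((i, j), k)"
      if i: "i < length ps" and j: "j < column_height ps i" for i j k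
    proof (cases k)
      case NW
      then show ?thesis
        using i j columns[OF i] height(1) top[of "prev_column ps i"]
        by (cases j) (simp_all add: c color_Suc color_SW)
    next
      case NE
      then show ?thesis
        using i j columns[OF i] height(1) top[of i] by (cases j) (simp_all add: c color_Suc)
    next
      case SE
      show ?thesis
      proof (cases "Suc j = column_height ps i")
        case True
        then have "j = column_height ps i - 1"
          by simp
        then show ?thesis
          using SE True i columns[OF i] height(1) bottom[OF i] by (simp add: c Let_def)
      next
        case False
        then show ?thesis
          using SE i j by (simp add: c color_Suc)
      qed
    next
      case SW
      show ?thesis
      proof (cases "Suc j = column_height ps i")
        case True
        then have "j = column_height ps i - 1"
          by simp
        then show ?thesis
          using SW True i columns[OF i] height(1) bottom[OF columns(2)[OF i]] by (simp add: c Let_def)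
      next
        case False
        then show ?thesis
          using SW i j by (simp add: c color_Suc)
      qed
    qed
    moreover have "c \<in> ends (pretzel ps) \<rightarrow>\<^sub>E {0..<n}"
      using n by (auto simp: c_def color_def)
    ultimately have "c \<in> ?C"
      by (auto simp: C ends_def crossings c color_SW color_SE)
    moreover have "a = ?r c"
    proof (rule ext)
      fix i
      have aE: "a \<in> {..<length ps} \<rightarrow>\<^sub>E {0..<n}"
        using a by (simp add: top_colorings_def)
      show "a i = ?r c i"
      proof (cases "i < length ps")
        case True
        then have "a i \<in> {0..<n}"
          using PiE_mem[OF aE] by simp
        then show ?thesis
          using True height(1) by (simp add: c color_def)
      next
        case False
        then show ?thesis
          using PiE_arb[OF aE, of i] by simp
      qed
    qed
    ultimately show "\<exists>c\<in>?C. a = ?r c"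
      by blast
  qed
qed

lemma card_quandle_hom_positive_pretzel:
  assumes "ps \<noteq> []" "\<forall>p\<in>set ps. p > 0" "n > 0" "orientation (pretzel ps) out"
  shows "card (quandle_hom (fundamental_quandle (pretzel ps) out) (dihedral_quandle n)) =
    card (top_colorings ps n)"
proof -
  have "is_diagram (pretzel ps)"
    using assms(1,2) by (intro is_diagram_pretzel) auto
  then show ?thesis
    using card_quandle_hom_fundamental_quandle[OF _ is_quandle_dihedral_quandle[OF assms(3)],
        of "pretzel ps" out]
      bij_betw_same_card[OF bij_betw_top_colorings[OF assms(2-4)]] by simp
qed

section \<open>Kernels of two by two matrices modulo n\<close>

text \<open>
  With \<open>g = gcd d n\<close>, the solutions are the multiples of \<open>n div g\<close>.
\<close>

lemma card_linear_congruence_homogeneous: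
  fixes d n :: int
  assumes "n > 0"
  shows "int (card {x \<in> {0..<n}. n dvd d * x}) = gcd d n"
proof -
  define g where "g = gcd d n"
  define m where "m = n div g"
  have g: "g > 0" and n: "n = g * m"
    using assms by (auto simp: g_def m_def)
  have m: "m > 0"
    using assms g n by (simp add: zero_less_mult_iff)
  have d: "d = g * (d div g)"
    by (simp add: g_def)
  have "coprime m (d div g)"
    using assms div_gcd_coprime[of d n] by (auto simp: m_def g_def coprime_commute)
  then have iff: "n dvd d * x \<longleftrightarrow> m dvd x" for x
    using g by (subst d, subst n) (auto simp: mult.assoc coprime_dvd_mult_right_iff)
  have "bij_betw (\<lambda>s. m * s) {0..<g} {x \<in> {0..<n}. n dvd d * x}"
    unfolding bij_betw_def iff
    using m by (auto simp: inj_on_def n elim!: dvdE simp: zero_le_mult_iff mult.commute)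
  then have "card {x \<in> {0..<n}. n dvd d * x} = card {0..<g}"
    using bij_betw_same_card by metis
  then show ?thesis
    using g by (simp add: g_def)
qed

text \<open>
  If there is a solution at all, then translation by it identifies the solutions with those of the
  homogeneous congruence.
\<close>

lemma card_linear_congruence:
  fixes d n b :: int
  assumes "n > 0"
  shows "int (card {y \<in> {0..<n}. n dvd b + d * y}) = (if gcd d n dvd b then gcd d n else 0)"
proof (cases "gcd d n dvd b")
  case False
  have "gcd d n dvd b" if "n dvd b + d * y" for y
    by (meson that dvd_add_left_iff dvd_mult2 dvd_trans gcd_dvd1 gcd_dvd2)
  then have "{y \<in> {0..<n}. n dvd b + d * y} = {}"
    using False by blast
  then show ?thesis
    using False by (simp only: card.empty) simp
next
  case True
  then obtain k where k: "b = gcd d n * k" ..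
  obtain u v where "u * d + v * n = gcd d n"
    using bezout_int by blast
  then have b: "b = d * (u * k) + n * (v * k)"
    by (simp add: k algebra_simps flip: distrib_right)
      (metis distrib_left mult.assoc mult.commute)
  define y0 where "y0 = - u * k"
  have iff: "n dvd b + d * y \<longleftrightarrow> n dvd d * (y - y0)" for y
  proof -
    have "b + d * y = d * (y - y0) + n * (v * k)"
      by (simp add: b y0_def algebra_simps)
    then show ?thesis
      by (simp add: dvd_add_left_iff)
  qed
  have mod_iff: "n dvd d * (x mod n) \<longleftrightarrow> n dvd d * x" for x
    by (simp add: dvd_eq_mod_eq_0 mod_mult_right_eq)
  have "bij_betw (\<lambda>x. (x + y0) mod n) {x \<in> {0..<n}. n dvd d * x} {y \<in> {0..<n}. n dvd b + d * y}"
  proof (rule bij_betw_byWitness[where f' = "\<lambda>y. (y - y0) mod n"])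
    have "n dvd d * ((x + y0) mod n - y0) \<longleftrightarrow> n dvd d * x" for x
      using mod_iff[of "(x + y0) mod n - y0"] mod_iff[of x]
      by (simp add: mod_diff_left_eq)
    then show "(\<lambda>x. (x + y0) mod n) ` {x \<in> {0..<n}. n dvd d * x} \<subseteq> {y \<in> {0..<n}. n dvd b + d * y}"
      using assms by (auto simp: iff)
  qed (use assms in \<open>auto simp: iff mod_iff mod_diff_left_eq mod_add_left_eq\<close>)
  then have "card {y \<in> {0..<n}. n dvd b + d * y} = card {x \<in> {0..<n}. n dvd d * x}"
    by (simp add: bij_betw_same_card)
  with True card_linear_congruence_homogeneous[OF assms, of d] show ?thesis
    by simp
qed

text \<open>
  Together with extensionality for divisors (\<open>int_eqI_dvd\<close>), the distributive law in this form
  reduces identities between nested gcds to propositional reasoning about divisibility.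
\<close>

lemma dvd_gcd_mult_iff:
  fixes k a b x :: int
  shows "k dvd gcd a b * x \<longleftrightarrow> k dvd a * x \<and> k dvd b * x"
proof -
  have "gcd (a * x) (b * x) = \<bar>gcd a b * x\<bar>"
    by (simp add: gcd_mult_right abs_mult gcd.commute)
  then show ?thesis
    by (metis dvd_abs_iff gcd_greatest_iff)
qed

lemma dvd_mult_gcd_iff:
  fixes k a b x :: int
  shows "k dvd x * gcd a b \<longleftrightarrow> k dvd x * a \<and> k dvd x * b"
  using dvd_gcd_mult_iff[of k a b x] by (simp add: mult.commute)

lemma int_eqI_dvd:
  fixes a b :: int
  assumes "a \<ge> 0" "b \<ge> 0" "\<And>k. k dvd a \<longleftrightarrow> k dvd b"
  shows "a = b"
  using assms(3)[of a] assms(3)[of b] assms(1,2) by (simp add: zdvd_antisym_nonneg)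

definition kernel_mod :: "int \<Rightarrow> int \<Rightarrow> int \<Rightarrow> int \<Rightarrow> int \<Rightarrow> (int \<times> int) set" where
  "kernel_mod n a b c d =
     {(x, y). x \<in> {0..<n} \<and> y \<in> {0..<n} \<and> n dvd a * x + b * y \<and> n dvd c * x + d * y}"

text \<open>
  For each \<open>x\<close> with \<open>a * x = 0\<close> modulo \<open>n\<close>, the second row is a linear congruence for \<open>y\<close>.
  It has \<open>e = gcd d n\<close> solutions if \<open>e\<close> divides \<open>c * x\<close>, and none otherwise. After scaling by
  \<open>n div e\<close>, this condition on \<open>x\<close> is again a congruence modulo \<open>n\<close>, and it merges with the
  first row into a single one with coefficient \<open>gcd a (c * (n div e))\<close>.
\<close>

lemma card_kernel_mod_triangular:
  fixes n a c d :: int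
  assumes n: "n > 0"
  shows "int (card (kernel_mod n a 0 c d)) = gcd (a * d) (n * gcd (gcd a (gcd c d)) n)"
proof -
  define e where "e = gcd d n"
  define A where "A = {x \<in> {0..<n}. n dvd a * x}"
  define m where "m = n div e"
  have e: "e > 0" and nm: "n = e * m"
    using n by (auto simp: e_def m_def)
  have fin: "finite A" "\<And>x. finite {y \<in> {0..<n}. n dvd c * x + d * y}"
    by (auto simp: A_def intro: finite_subset[of _ "{0..<n}"])
  have "kernel_mod n a 0 c d = (SIGMA x:A. {y \<in> {0..<n}. n dvd c * x + d * y})"
    by (auto simp: kernel_mod_def A_def)
  then have "int (card (kernel_mod n a 0 c d)) = (\<Sum>x\<in>A. int (card {y \<in> {0..<n}. n dvd c * x + d * y}))"
    using fin by simp
  also have "\<dots> = (\<Sum>x\<in>A. if e dvd c * x then e else 0)"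
    unfolding card_linear_congruence[OF n] e_def ..
  also have "\<dots> = e * int (card {x \<in> A. e dvd c * x})"
    using fin by (simp add: sum.If_cases Int_def)
  also have "{x \<in> A. e dvd c * x} = {x \<in> {0..<n}. n dvd gcd a (c * m) * x}"
  proof -
    have "m \<noteq> 0"
      using n nm by auto
    then have "e dvd c * x \<longleftrightarrow> n dvd c * m * x" for x
      using dvd_mult_cancel_left[of m e "c * x"] by (simp add: nm ac_simps)
    moreover have "n dvd a * x \<and> n dvd c * m * x \<longleftrightarrow> n dvd gcd a (c * m) * x" for x
      by (simp add: dvd_gcd_mult_iff)
    ultimately show ?thesis
      by (auto simp: A_def)
  qed
  also have "e * int (card \<dots>) = e * gcd (gcd a (c * m)) n"
    unfolding card_linear_congruence_homogeneous[OF n] ..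
  also have "\<dots> = gcd (a * d) (n * gcd (gcd a (gcd c d)) n)"
  proof (rule int_eqI_dvd)
    fix k
    have "k dvd e * gcd (gcd a (c * m)) n \<longleftrightarrow> k dvd e * a \<and> k dvd c * n \<and> k dvd e * n"
      by (simp add: dvd_mult_gcd_iff nm ac_simps)
    also have "\<dots> \<longleftrightarrow> k dvd gcd (a * d) (n * gcd (gcd a (gcd c d)) n)"
      by (auto simp: e_def dvd_mult_gcd_iff dvd_gcd_mult_iff ac_simps)
    finally show "k dvd e * gcd (gcd a (c * m)) n \<longleftrightarrow>
      k dvd gcd (a * d) (n * gcd (gcd a (gcd c d)) n)" .
  qed (use e in auto)
  finally show ?thesis .
qed

lemma unimodular_column_reduction:
  fixes a b :: int
  obtains u v w z where "u * z - v * w = 1" "a * u + b * v = gcd a b" "a * w + b * z = 0"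
proof (cases "a = 0 \<and> b = 0")
  case True
  then show ?thesis
    using that[of 1 1 0 0] by simp
next
  case False
  define g where "g = gcd a b"
  have g: "g \<noteq> 0" "a = g * (a div g)" "b = g * (b div g)"
    using False by (auto simp: g_def)
  obtain u v where uv: "u * a + v * b = g"
    unfolding g_def using bezout_int by blast
  have "g * (u * (a div g) - v * (- (b div g))) = u * (g * (a div g)) + v * (g * (b div g))"
    by (simp add: algebra_simps)
  also have "\<dots> = g * 1"
    using uv g(2,3) by simp
  finally have "u * (a div g) - v * (- (b div g)) = 1"
    using g(1) mult_cancel_left by blast
  moreover have "a * (- (b div g)) + b * (a div g) = 0"
    by (subst (1) g(2), subst (2) g(3)) (simp add: algebra_simps)
  ultimately show ?thesis
    using that[of u "a div g" v "- (b div g)"] uv by (simp add: g_def algebra_simps)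
qed

text \<open>
  A column operation with determinant 1 is an invertible change of the unknowns modulo \<open>n\<close>.
\<close>

lemma card_kernel_mod_column_operation:
  fixes n a b c d u v w z :: int
  assumes n: "n > 0" and det: "u * z - v * w = 1"
  shows "card (kernel_mod n (a * u + b * v) (a * w + b * z) (c * u + d * v) (c * w + d * z)) =
    card (kernel_mod n a b c d)"
proof -
  have mod_mod: "(p * (x mod n) + q * (y mod n)) mod n = (p * x + q * y) mod n" for p q x y
    by (intro mod_add_cong mod_mult_right_eq)
  then have mod_iff: "n dvd p * (x mod n) + q * (y mod n) \<longleftrightarrow> n dvd p * x + q * y" for p q x y
    by (simp only: dvd_eq_mod_eq_0)
  let ?f = "\<lambda>(s, t). ((u * s + w * t) mod n, (v * s + z * t) mod n)"
  let ?g = "\<lambda>(x, y). ((z * x + - w * y) mod n, (- v * x + u * y) mod n)"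
  have [simp]: "z * u + - w * v = 1" "z * w + - w * z = 0" "- v * u + u * v = 0" "- v * w + u * z = 1"
    using det by algebra+
  have [simp]: "u * (z * s + - w * t) + w * (- v * s + u * t) = s"
    "v * (z * s + - w * t) + z * (- v * s + u * t) = t" for s t
    using det by algebra+
  have f: "p * (u * s + w * t) + q * (v * s + z * t) = (p * u + q * v) * s + (p * w + q * z) * t"
    for p q s t
    by algebra
  have g: "(p * u + q * v) * (z * x + - w * y) + (p * w + q * z) * (- v * x + u * y) = p * x + q * y"
    for p q x y
    using det by algebra
  have "bij_betw ?f
      (kernel_mod n (a * u + b * v) (a * w + b * z) (c * u + d * v) (c * w + d * z))
      (kernel_mod n a b c d)"
    using n
    by (intro bij_betw_byWitness[where f' = ?g])
      (auto simp: kernel_mod_def mod_iff mod_mod f g simp del: mult_minus_left)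
  then show ?thesis
    by (rule bij_betw_same_card)
qed

text \<open>
  One column operation makes the matrix lower triangular. It changes neither the determinant nor the
  gcd of the entries in each row, so the triangular count carries over. The full Smith normal form is
  thus avoided.
\<close>

lemma card_kernel_mod:
  fixes n a b c d :: int
  assumes n: "n > 0"
  shows "int (card (kernel_mod n a b c d)) =
    gcd (a * d - b * c) (n * gcd (gcd (gcd a b) (gcd c d)) n)"
proof -
  obtain u v w z where uvwz: "u * z - v * w = 1" "a * u + b * v = gcd a b" "a * w + b * z = 0"
    by (rule unimodular_column_reduction)
  define c' d' where "c' = c * u + d * v" and "d' = c * w + d * z"
  have "card (kernel_mod n a b c d) = card (kernel_mod n (gcd a b) 0 c' d')"
    using card_kernel_mod_column_operation[OF n uvwz(1), of a b c d] uvwz by (simp add: c'_def d'_def)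
  moreover have "gcd a b * d' = a * d - b * c"
    using uvwz unfolding d'_def by algebra
  moreover have "gcd c' d' = gcd c d"
  proof (rule int_eqI_dvd)
    have "c = z * c' - v * d'" "d = u * d' - w * c'"
      using uvwz(1) unfolding c'_def d'_def by algebra+
    then show "k dvd gcd c' d' \<longleftrightarrow> k dvd gcd c d" for k
      by (metis c'_def d'_def dvd_add dvd_diff dvd_mult dvd_mult2 gcd_greatest_iff)
  qed auto
  ultimately show ?thesis
    by (simp add: card_kernel_mod_triangular[OF n])
qed

text \<open>
  Multiplying out, the right hand side is the gcd of \<open>P\<close>, \<open>g * n\<close>, \<open>n * (P div g)\<close> and
  \<open>n * n\<close>. The third of these is a multiple of the second, since \<open>g\<close> divides \<open>P div g\<close>.
\<close>

lemma gcd_det_eq_gcd_invariant_factors: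
  fixes g P n :: int
  assumes "g \<noteq> 0" "g * g dvd P"
  shows "gcd P (n * gcd g n) = gcd g n * gcd (P div g) n"
proof (rule int_eqI_dvd)
  obtain m where P: "P = g * (g * m)"
    using assms(2) by (metis dvdE mult.assoc)
  fix k
  have "k dvd n * (g * m)" if "k dvd n * g"
    using that by (metis dvd_mult2 mult.assoc)
  moreover have "P div g = g * m"
    using assms(1) by (simp add: P)
  ultimately show "k dvd gcd P (n * gcd g n) \<longleftrightarrow> k dvd gcd g n * gcd (P div g) n"
    by (auto simp: P dvd_gcd_mult_iff dvd_mult_gcd_iff mult.commute[of n g])
qed auto

section \<open>Pretzel links with three columns\<close>

text \<open>
  The three conditions run around a cycle, so the third one follows from the other two.
\<close>

lemma top_colorings_three_columns:
  "top_colorings [p1, p2, p3] n =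
    {a \<in> {..<3} \<rightarrow>\<^sub>E {0..<n}. n dvd p1 * (a 1 - a 0) - p2 * (a 2 - a 1) \<and>
       n dvd p2 * (a 2 - a 1) - p3 * (a 0 - a 2)}"
proof -
  have "(ps ! 0 * (a 1 - a 0)) mod n = (ps ! 1 * (a 2 - a 1)) mod n \<and>
      (ps ! 1 * (a 2 - a 1)) mod n = (ps ! 2 * (a 0 - a 2)) mod n \<longleftrightarrow>
      (\<forall>i<length ps. let i' = next_column ps i in
        (ps ! i * (a i' - a i)) mod n = (ps ! i' * (a (next_column ps i') - a i')) mod n)"
    if "ps = [p1, p2, p3]" for ps and a :: "nat \<Rightarrow> int"
    using that by (auto simp: All_less_Suc next_column_def numeral_2_eq_2)
  from this[OF HOL.refl] show ?thesis
    by (simp add: top_colorings_def numeral_3_eq_3 numeral_2_eq_2 flip: mod_eq_dvd_iff)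
qed

text \<open>
  The top colours correspond to the first of them together with the first two differences; the third
  difference is minus their sum, which turns the second condition into the second row of the matrix.
\<close>

lemma card_top_colorings_three_columns:
  assumes n: "n > 0"
  shows "int (card (top_colorings [p1, p2, p3] n)) =
    n * int (card (kernel_mod n p1 (- p2) p3 (p2 + p3)))"
proof -
  let ?K = "kernel_mod n p1 (- p2) p3 (p2 + p3)" and ?T = "top_colorings [p1, p2, p3] n"
  let ?f = "\<lambda>(r, x, y). \<lambda>i\<in>{..<3::nat}.
    if i = 0 then r else if i = 1 then (r + x) mod n else (r + x + y) mod n"
  let ?g = "\<lambda>a::nat \<Rightarrow> int. (a 0, (a 1 - a 0) mod n, (a 2 - a 1) mod n)"
  have kernel_iff: "(n dvd p1 * (a1 - a0) - p2 * (a2 - a1) \<and> n dvd p2 * (a2 - a1) - p3 * (a0 - a2)) \<longleftrightarrow>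
      (n dvd p1 * x + - p2 * y \<and> n dvd p3 * x + (p2 + p3) * y)"
    if "(a1 - a0) mod n = x mod n" "(a2 - a1) mod n = y mod n" for a0 a1 a2 x y
  proof -
    have lin: "(p * x + q * y) mod n = (p * (a1 - a0) + q * (a2 - a1)) mod n" for p q
      by (intro mod_add_cong mod_mult_cong HOL.refl that[symmetric])
    have "p2 * (a2 - a1) - p3 * (a0 - a2) = p3 * (a1 - a0) + (p2 + p3) * (a2 - a1)"
      "p1 * (a1 - a0) - p2 * (a2 - a1) = p1 * (a1 - a0) + - p2 * (a2 - a1)"
      by algebra+
    then show ?thesis
      by (simp only: dvd_eq_mod_eq_0 lin)
  qed
  have "bij_betw ?f ({0..<n} \<times> ?K) ?T"
  proof (rule bij_betw_byWitness[where f' = ?g])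
    show "\<forall>rxy\<in>{0..<n} \<times> ?K. ?g (?f rxy) = rxy"
    proof
      fix rxy assume "rxy \<in> {0..<n} \<times> ?K"
      then obtain r x y where rxy: "rxy = (r, x, y)" "(x, y) \<in> ?K"
        by auto
      have "((r + x) mod n - r) mod n = x mod n" "((r + x + y) mod n - (r + x) mod n) mod n = y mod n"
        by (simp_all add: mod_simps)
      then show "?g (?f rxy) = rxy"
        using rxy by (simp add: kernel_mod_def)
    qed
    show "\<forall>a\<in>?T. ?f (?g a) = a"
    proof
      fix a assume "a \<in> ?T"
      then have a: "a \<in> {..<3} \<rightarrow>\<^sub>E {0..<n}"
        by (simp add: top_colorings_three_columns)
      have range: "a 1 \<in> {0..<n}" "a 2 \<in> {0..<n}"
        by (rule PiE_mem[OF a], simp)+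
      have color_1: "(a 0 + (a 1 - a 0) mod n) mod n = a 1"
        using range(1) by (simp add: mod_add_right_eq)
      have "(a 0 + (a 1 - a 0) mod n + (a 2 - a 1) mod n) mod n =
          (a 0 + (a 1 - a 0) + (a 2 - a 1)) mod n"
        by (intro mod_add_cong mod_mod_trivial HOL.refl)
      also have "\<dots> = a 2"
        using range(2) by simp
      finally have color_2: "(a 0 + (a 1 - a 0) mod n + (a 2 - a 1) mod n) mod n = a 2" .
      show "?f (?g a) = a"
      proof (rule ext)
        fix i :: nat
        consider "i = 0" | "i = 1" | "i = 2" | "i \<ge> 3"
          by linarith
        then show "?f (?g a) i = a i"
        proof cases
          case 2
          then show ?thesis
            using color_1 by simp
        next
          case 3
          then show ?thesis
            using color_2 by simp
        qed (simp_all add: PiE_arb[OF a])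
      qed
    qed
    show "?f ` ({0..<n} \<times> ?K) \<subseteq> ?T"
    proof (rule image_subsetI)
      fix rxy assume "rxy \<in> {0..<n} \<times> ?K"
      then obtain r x y where rxy: "rxy = (r, x, y)" "r \<in> {0..<n}" "(x, y) \<in> ?K"
        by auto
      have "((r + x) mod n - r) mod n = x mod n" "((r + x + y) mod n - (r + x) mod n) mod n = y mod n"
        by (simp_all add: mod_simps)
      note iff = kernel_iff[OF this]
      have "?f rxy \<in> {..<3} \<rightarrow>\<^sub>E {0..<n}"
        using n rxy(1,2) by auto
      moreover have "?f rxy 0 = r" "?f rxy 1 = (r + x) mod n" "?f rxy 2 = (r + x + y) mod n"
        by (simp_all add: rxy(1))
      ultimately show "?f rxy \<in> ?T"
        using rxy(3) unfolding top_colorings_three_columns kernel_mod_def mem_Collect_eq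
        by (simp only: iff prod.case simp_thms)
    qed
    show "?g ` ?T \<subseteq> {0..<n} \<times> ?K"
    proof (rule image_subsetI)
      fix a assume a: "a \<in> ?T"
      then have "a 0 \<in> {0..<n}"
        unfolding top_colorings_three_columns mem_Collect_eq
        by (blast intro: PiE_mem zero_less_numeral)
      define x y where "x = (a 1 - a 0) mod n" and "y = (a 2 - a 1) mod n"
      then have "x \<in> {0..<n}" "y \<in> {0..<n}"
        using n by simp_all
      moreover have "(a 1 - a 0) mod n = x mod n" "(a 2 - a 1) mod n = y mod n"
        by (simp_all add: x_def y_def)
      then have "n dvd p1 * x + - p2 * y \<and> n dvd p3 * x + (p2 + p3) * y"
        using a kernel_iff unfolding top_colorings_three_columns by blast
      ultimately have "(x, y) \<in> ?K"
        by (simp add: kernel_mod_def)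
      with \<open>a 0 \<in> {0..<n}\<close> show "?g a \<in> {0..<n} \<times> ?K"
        by (simp add: x_def y_def)
    qed
  qed
  then have "card ?T = card ({0..<n} \<times> ?K)"
    by (rule bij_betw_same_card[symmetric])
  then show ?thesis
    using n by (simp add: card_cartesian_product)
qed

theorem theorem20:
  fixes p1 p2 p3 n :: int and out :: "(nat \<times> nat) \<times> corner \<Rightarrow> bool"
  assumes "p1 > 0" "p2 > 0" "p3 > 0" "n > 0"
    and "orientation (pretzel [p1, p2, p3]) out"
  defines "P \<equiv> p1 * p2 + p1 * p3 + p2 * p3"
    and "Q \<equiv> gcd p1 (gcd p2 p3)"
  defines "D1 \<equiv> gcd Q n"
    and "D2 \<equiv> gcd (\<bar>P\<bar> div Q) n"
  shows "int (card (quandle_hom (fundamental_quandle (pretzel [p1, p2, p3]) out) (dihedral_quandle n))) =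
    (if gcd P n = 1 then n else D1 * D2 * n)"
proof -
  have Q: "Q \<noteq> 0" "Q dvd p1" "Q dvd p2" "Q dvd p3"
    using assms(1) by (auto simp: Q_def intro: dvd_trans[OF gcd_dvd2])
  have "P > 0"
    using assms(1-3) by (simp add: P_def add_pos_pos)
  have QQ: "Q * Q dvd P"
    unfolding P_def using Q by (intro dvd_add mult_dvd_mono)
  have "gcd (gcd p1 (- p2)) (gcd p3 (p2 + p3)) = Q"
  proof (rule int_eqI_dvd)
    show "k dvd gcd (gcd p1 (- p2)) (gcd p3 (p2 + p3)) \<longleftrightarrow> k dvd Q" for k
      by (auto simp: Q_def dvd_add_left_iff)
  qed (auto simp: Q_def)
  moreover have "p1 * (p2 + p3) - - p2 * p3 = P"
    by (simp add: P_def algebra_simps)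
  ultimately have "int (card (kernel_mod n p1 (- p2) p3 (p2 + p3))) = gcd P (n * gcd Q n)"
    by (simp add: card_kernel_mod[OF assms(4)])
  also have "\<dots> = D1 * D2"
    using gcd_det_eq_gcd_invariant_factors[OF Q(1) QQ] \<open>P > 0\<close> by (simp add: D1_def D2_def)
  finally have "int (card (quandle_hom (fundamental_quandle (pretzel [p1, p2, p3]) out)
      (dihedral_quandle n))) = D1 * D2 * n"
    using card_quandle_hom_positive_pretzel[of "[p1, p2, p3]" n out] assms(1-5)
      card_top_colorings_three_columns[of n p1 p2 p3] by simp
  \<comment> \<open>For \<open>P\<close> coprime to \<open>n\<close>, the general value already agrees with the first case.\<close>
  moreover have "D1 * D2 = 1" if "gcd P n = 1"
  proof -
    have "Q dvd P" "\<bar>P\<bar> div Q dvd P"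
      using QQ \<open>P > 0\<close> dvd_mult_left[OF QQ] by (auto elim: dvdE simp: div_dvd_iff_mult Q(1))
    then have "gcd Q n dvd gcd P n" "gcd (\<bar>P\<bar> div Q) n dvd gcd P n"
      by (auto intro: dvd_trans[OF gcd_dvd1])
    then have "D1 dvd 1" "D2 dvd 1"
      by (simp_all add: that D1_def D2_def)
    then show ?thesis
      by (simp add: D1_def D2_def)
  qed
  ultimately show ?thesis
    by simp
qed

end
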